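(* Let $d\ge1$ and $0\le k\le d$. The Cartesian product of the cubes $C_x=[0,1]^d$ and $C_y=[0,1]^k\times[-1,0]^{d-k}$ (with coordinates reordered as $(x_1,y_1,\dots,x_d,y_d)$) has the following decomposition into convex hulls of singular and nonsingular faces: $$C_x\times C_y=\bigcup_{\ell=2}^{k+1}\ \bigcup_{F\in\mathcal{B}^{(\ell)}_1}\mathrm{conv}(A_F,F)\ \ \cup\ \ \bigcup_{\ell=1}^{k+1}\ \bigcup_{F\in\mathcal{B}^{(\ell)}_2}\mathrm{conv}(A_F,F).$$ The total number of terms is $(6d-4k)\,3^{k-1}$.
   Context: A decomposition is a representation as a union of sets whose interiors are pairwise disjoint. For polytopes $A,B$, $\mathrm{conv}(A,B)=\{(1-\lambda)\mathbf{x}_A+\lambda\mathbf{x}_B:\lambda\in[0,1],\ \mathbf{x}_A\in A,\ \mathbf{x}_B\in B\}$. In the plane define the squares $S=[0,1]^2$ and $T=[0,1]\times[-1,0]$, the points $\mathbf{v}_0=(0,0)$, $\mathbf{v}_1=(1,1)$, $\mathbf{v}_2=(1,0)$, $\mathbf{v}_3=(0,1)$, and the edges $$E_2=\{1\}\times[0,1],\quad E_3=[0,1]\times\{1\},\quad G_2=\{1\}\times[-1,0],\quad G_3=[0,1]\times\{-1\}.$$ After reordering coordinates as $(x_1,y_1,\dots,x_d,y_d)$, $C_x\times C_y$ is identified with $P=S\times\dots\times S\times T\times\dots\times T$, with $k$ factors $S$ followed by $d-k$ factors $T$. For a product $F=F_1\times\dots\times F_d$ with $F_i\in\{S,E_2,E_3,\mathbf{v}_2,\mathbf{v}_3\}$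 for $i\le k$ and $F_i\in\{T,G_2,G_3\}$ for $i>k$ (points are identified with singletons), let $n_E(F)=\#\{i:F_i\in\{E_2,E_3\}\}$, $n_G(F)=\#\{i:F_i\in\{G_2,G_3\}\}$, $n_V(F)=\#\{i:F_i\in\{\mathbf{v}_2,\mathbf{v}_3\}\}$. For $\ell\ge1$, $\mathcal{B}^{(\ell+1)}_1$ is the set of $F=F_1\times\dots\times F_d$ with $F_i\in\{S,E_2,E_3,\mathbf{v}_2,\mathbf{v}_3\}$ for $i\le k$, $F_i=T$ for $i>k$, $n_V(F)=1$ and $n_E(F)=\ell-1$. For $\ell\ge0$, $\mathcal{B}^{(\ell+1)}_2$ is the set of $F=F_1\times\dots\times F_d$ with $F_i\in\{S,E_2,E_3\}$ for $i\le k$, $F_i\in\{T,G_2,G_3\}$ for $i>k$, $n_G(F)=1$ and $n_E(F)=\ell$. For $F$ in one of these sets, $A_F=I_{\sigma_1}\times\dots\times I_{\sigma_d}$, where $\sigma_i=1$ if $F_i\in\{E_2,E_3,\mathbf{v}_2,\mathbf{v}_3\}$ and $\sigma_i=0$ if $F_i\in\{S,T,G_2,G_3\}$, with $I_0=\{\mathbf{v}_0\}$ and $I_1=[\mathbf{v}_0,\mathbf{v}_1]$ the segment from $(0,0)$ to $(1,1)$ in the plane. *)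

theory Defs
  imports "HOL-Analysis.Analysis"
begin

text \<open>
  The \<open>d\<close> factors of the plane are indexed by a finite linearly ordered type \<open>'n\<close> with
  \<open>d = CARD('n)\<close>. The element \<open>i :: 'n\<close> plays the role of the index \<open>pos i\<close> in \<open>1, \<dots>, d\<close>,
  so "\<open>i \<le> k\<close>" in the paper reads \<open>pos i \<le> k\<close>. The space with coordinates
  \<open>(x\<^sub>1, y\<^sub>1, \<dots>, x\<^sub>d, y\<^sub>d)\<close> is \<open>(real \<times> real) ^ 'n\<close>.
\<close>

definition pos :: "'n::{finite,linorder} \<Rightarrow> nat" where
  "pos i = card {j. j \<le> i}"

definition C_x :: "(real ^ 'n::finite) set" where
  "C_x = {x. \<forall>i. x $ i \<in> {0..1}}"

definition C_y :: "nat \<Rightarrow> (real ^ 'n::{finite,linorder}) set" where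
  "C_y k = {y. \<forall>i. y $ i \<in> (if pos i \<le> k then {0..1} else {-1..0})}"

definition reorder :: "(real ^ 'n) \<times> (real ^ 'n) \<Rightarrow> (real \<times> real) ^ 'n::finite" where
  "reorder = (\<lambda>(x, y). \<chi> i. (x $ i, y $ i))"

definition S_sq :: "(real \<times> real) set" where "S_sq = {0..1} \<times> {0..1}"
definition T_sq :: "(real \<times> real) set" where "T_sq = {0..1} \<times> {-1..0}"

definition v0 :: "real \<times> real" where "v0 = (0, 0)"
definition v1 :: "real \<times> real" where "v1 = (1, 1)"
definition v2 :: "real \<times> real" where "v2 = (1, 0)"
definition v3 :: "real \<times> real" where "v3 = (0, 1)"

definition E2 :: "(real \<times> real) set" where "E2 = {1} \<times> {0..1}"
definition E3 :: "(real \<times> real) set" where "E3 = {0..1} \<times> {1}"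
definition G2 :: "(real \<times> real) set" where "G2 = {1} \<times> {-1..0}"
definition G3 :: "(real \<times> real) set" where "G3 = {0..1} \<times> {-1}"

definition conv :: "'a::real_vector set \<Rightarrow> 'a set \<Rightarrow> 'a set" where
  "conv A B = {(1 - t) *\<^sub>R a + t *\<^sub>R b | t a b. t \<in> {0..1} \<and> a \<in> A \<and> b \<in> B}"

text \<open>
  A product \<open>F\<^sub>1 \<times> \<dots> \<times> F\<^sub>d\<close> is represented by its family of factors \<open>F\<close>;
  the point set itself is \<open>face F\<close>.
\<close>

definition face :: "('n::finite \<Rightarrow> (real \<times> real) set) \<Rightarrow> ((real \<times> real) ^ 'n) set" where
  "face F = {p. \<forall>i. p $ i \<in> F i}"

definition n_E :: "('n::finite \<Rightarrow> (real \<times> real) set) \<Rightarrow> nat" where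
  "n_E F = card {i. F i \<in> {E2, E3}}"

definition n_G :: "('n::finite \<Rightarrow> (real \<times> real) set) \<Rightarrow> nat" where
  "n_G F = card {i. F i \<in> {G2, G3}}"

definition n_V :: "('n::finite \<Rightarrow> (real \<times> real) set) \<Rightarrow> nat" where
  "n_V F = card {i. F i \<in> {{v2}, {v3}}}"

text \<open>
  The argument \<open>l\<close> below is the superscript itself: the paper's condition \<open>n\<^sub>E = \<ell> - 1\<close> for
  superscript \<open>\<ell> + 1\<close> becomes \<open>n_E F + 2 = l\<close>, and \<open>n\<^sub>E = \<ell>\<close> becomes \<open>n_E F + 1 = l\<close>.
\<close>

definition B1 :: "nat \<Rightarrow> nat \<Rightarrow> ('n::{finite,linorder} \<Rightarrow> (real \<times> real) set) set" where
  "B1 k l = {F. (\<forall>i. F i \<in> (if pos i \<le> k then {S_sq, E2, E3, {v2}, {v3}} else {T_sq})) \<and>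
     n_V F = 1 \<and> n_E F + 2 = l}"

definition B2 :: "nat \<Rightarrow> nat \<Rightarrow> ('n::{finite,linorder} \<Rightarrow> (real \<times> real) set) set" where
  "B2 k l = {F. (\<forall>i. F i \<in> (if pos i \<le> k then {S_sq, E2, E3} else {T_sq, G2, G3})) \<and>
     n_G F = 1 \<and> n_E F + 1 = l}"

definition sigma_of :: "('n \<Rightarrow> (real \<times> real) set) \<Rightarrow> 'n \<Rightarrow> nat" where
  "sigma_of F i = (if F i \<in> {E2, E3, {v2}, {v3}} then 1 else 0)"

definition I_set :: "nat \<Rightarrow> (real \<times> real) set" where
  "I_set s = (if s = 0 then {v0} else closed_segment v0 v1)"

definition A_face :: "('n::finite \<Rightarrow> (real \<times> real) set) \<Rightarrow> ((real \<times> real) ^ 'n) set" where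
  "A_face F = face (\<lambda>i. I_set (sigma_of F i))"

text \<open>
  The terms of the union as an indexed family: a term is a position in one of the two double
  unions, so nothing is identified when terms are counted or compared.
\<close>

type_synonym 'n index = "nat \<times> ('n \<Rightarrow> (real \<times> real) set)"

definition union_terms :: "nat \<Rightarrow> ('n::{finite,linorder} index + 'n index) set" where
  "union_terms k = (SIGMA l:{2..k+1}. B1 k l) <+> (SIGMA l:{1..k+1}. B2 k l)"

definition piece :: "'n::finite index + 'n index \<Rightarrow> ((real \<times> real) ^ 'n) set" where
  "piece t = (let F = case_sum snd snd t in conv (A_face F) (face F))"

end

theory Submission imports Defs begin

text \<open>
  Put \<open>t p = max\<^sub>i h\<^sub>i p\<close>, where \<open>h\<^sub>i = \<bar>x\<^sub>i - y\<^sub>i\<bar>\<close> on the factors \<open>S\<close> and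
  \<open>h\<^sub>i = max x\<^sub>i (- y\<^sub>i)\<close> on the factors \<open>T\<close>. Every representation \<open>p = (1 - t) a + t b\<close> with
  \<open>a \<in> A\<^sub>F\<close>, \<open>b \<in> F\<close> has \<open>t = t p\<close>: the one factor of \<open>F\<close> that is a vertex or an edge of \<open>T\<close>
  sits at an index where the maximum is attained and records which linear function attains it.
  For fixed \<open>t\<close> the membership condition splits into the factors, and in each square \<open>S\<close> the
  slices of \<open>S\<close>, \<open>E\<^sub>2\<close>, \<open>E\<^sub>3\<close> tile the region \<open>\<bar>x - y\<bar> \<le> t\<close>. Two different pieces
  therefore meet only inside a hyperplane.
\<close>

section \<open>The planar factors and their slices at a fixed parameter\<close>

lemma distinct_squares: "distinct [S_sq, T_sq, E2, E3, G2, G3, {v2}, {v3}]"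
proof -
  \<comment> \<open>Membership of these four points gives each of the eight sets its own
    signature.\<close>
  let ?f = "\<lambda>X. ((0, 0) \<in> X, (1, 1) \<in> X, (1, 0) \<in> X, (1, - 1) \<in> X)"
  have "distinct (map ?f [S_sq, T_sq, E2, E3, G2, G3, {v2}, {v3}])"
    by (simp add: S_sq_def T_sq_def E2_def E3_def G2_def G3_def v2_def v3_def)
  then show ?thesis
    unfolding distinct_map by blast
qed

lemmas squares_neq =
  distinct_squares[simplified] distinct_squares[THEN distinct_rev[THEN iffD2], simplified]

lemma mem_S_sq: "(x, y) \<in> S_sq \<longleftrightarrow> 0 \<le> x \<and> x \<le> 1 \<and> 0 \<le> y \<and> y \<le> 1"
  by (auto simp: S_sq_def)

lemma mem_T_sq: "(x, y) \<in> T_sq \<longleftrightarrow> 0 \<le> x \<and> x \<le> 1 \<and> - 1 \<le> y \<and> y \<le> 0"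
  by (auto simp: T_sq_def)

text \<open>The points that one factor of the convex hull can take at parameter \<open>t\<close>.
  Since \<open>sigma_of\<close> takes a family but inspects a single member, a constant family over
  \<open>unit\<close> applies it to one planar set.\<close>

definition slice :: "real \<Rightarrow> (real \<times> real) set \<Rightarrow> (real \<times> real) set" where
  "slice t X = {(1 - t) *\<^sub>R a + t *\<^sub>R b | a b. a \<in> I_set (sigma_of (\<lambda>_. X) ()) \<and> b \<in> X}"

text \<open>\<open>A_face F\<close> and \<open>face F\<close> are products over the same indices, so
  convex combinations are formed coordinatewise; the factors are coupled only through the common
  \<open>t\<close>.\<close>

lemma mem_conv_A_face:
  "p \<in> conv (A_face F) (face F) \<longleftrightarrow> (\<exists>t\<in>{0..1}. \<forall>i. p $ i \<in> slice t (F i))"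
proof
  assume "p \<in> conv (A_face F) (face F)"
  then obtain t a b where "p = (1 - t) *\<^sub>R a + t *\<^sub>R b" and t: "t \<in> {0..1}"
      and ab: "a \<in> A_face F" "b \<in> face F"
    unfolding conv_def by blast
  then have "p $ i = (1 - t) *\<^sub>R (a $ i) + t *\<^sub>R (b $ i)" for i by simp
  moreover have "a $ i \<in> I_set (sigma_of F i)" "b $ i \<in> F i" for i
    using ab by (simp_all add: A_face_def face_def)
  ultimately have "p $ i \<in> slice t (F i)" for i
    unfolding slice_def sigma_of_def by blast
  with t show "\<exists>t\<in>{0..1}. \<forall>i. p $ i \<in> slice t (F i)" by blast
next
  assume "\<exists>t\<in>{0..1}. \<forall>i. p $ i \<in> slice t (F i)"
  then obtain t where t: "t \<in> {0..1}" and "\<forall>i. p $ i \<in> slice t (F i)" by blast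
  then have "\<forall>i. \<exists>a b. p $ i = (1 - t) *\<^sub>R a + t *\<^sub>R b \<and> a \<in> I_set (sigma_of F i) \<and> b \<in> F i"
    by (simp add: slice_def sigma_of_def)
  then obtain a b where ab: "\<And>i. p $ i = (1 - t) *\<^sub>R a i + t *\<^sub>R b i"
      "\<And>i. a i \<in> I_set (sigma_of F i)" "\<And>i. b i \<in> F i"
    by metis
  have "p = (1 - t) *\<^sub>R (\<chi> i. a i) + t *\<^sub>R (\<chi> i. b i)"
    by (simp add: vec_eq_iff ab)
  moreover have "(\<chi> i. a i) \<in> A_face F" "(\<chi> i. b i) \<in> face F"
    by (simp_all add: A_face_def face_def ab)
  ultimately show "p \<in> conv (A_face F) (face F)"
    using t unfolding conv_def by blast
qed

lemma I_set_0: "I_set 0 = {(0, 0)}"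
  by (simp add: I_set_def v0_def)

lemma I_set_1: "I_set (Suc 0) = (\<lambda>s. (s, s)) ` {0..1}"
  by (auto simp: I_set_def v0_def v1_def closed_segment_def image_iff)

lemma slice_flat:
  assumes "X \<in> {S_sq, T_sq, G2, G3}"
  shows "slice t X = {(t * u, t * v) | u v. (u, v) \<in> X}"
proof -
  have "sigma_of (\<lambda>_. X) () = 0"
    using assms by (auto simp: sigma_of_def squares_neq)
  then have "slice t X = {t *\<^sub>R b | b. b \<in> X}"
    by (simp add: slice_def I_set_0 scaleR_prod_def)
  also have "\<dots> = {(t * u, t * v) | u v. (u, v) \<in> X}"
    by (auto simp: set_eq_iff)
  finally show ?thesis .
qed

text \<open>Here the scaled copy of \<open>X\<close> is swept along the diagonal from the origin to
  \<open>(1 - t, 1 - t)\<close>, while for the flat factors only the scaled copy remains.\<close>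

lemma slice_diag:
  assumes "X \<in> {E2, E3, {v2}, {v3}}"
  shows "slice t X = {((1 - t) * s + t * u, (1 - t) * s + t * v) | s u v. s \<in> {0..1} \<and> (u, v) \<in> X}"
proof -
  have "sigma_of (\<lambda>_. X) () = 1"
    using assms by (auto simp: sigma_of_def)
  then have "slice t X = {(1 - t) *\<^sub>R (s, s) + t *\<^sub>R b | s b. s \<in> {0..1} \<and> b \<in> X}"
    unfolding slice_def One_nat_def by (simp only: I_set_1) blast
  also have "\<dots> = {((1 - t) * s + t * u, (1 - t) * s + t * v) | s u v. s \<in> {0..1} \<and> (u, v) \<in> X}"
    by (simp add: set_eq_iff)
  finally show ?thesis .
qed

context
  fixes t :: real
  assumes t: "0 \<le> t" "t \<le> 1"
begin

lemma between_one:
  "(\<exists>s. 0 \<le> s \<and> s \<le> 1 \<and> x = (1 - t) * s + t) \<longleftrightarrow> t \<le> x \<and> x \<le> 1"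
proof
  assume "\<exists>s. 0 \<le> s \<and> s \<le> 1 \<and> x = (1 - t) * s + t"
  then obtain s where s: "0 \<le> s" "s \<le> 1" "x = (1 - t) * s + t" by blast
  then have "0 \<le> (1 - t) * s" "(1 - t) * s \<le> 1 - t" using t by (auto simp: mult_left_le)
  then show "t \<le> x \<and> x \<le> 1" using s by linarith
next
  assume x: "t \<le> x \<and> x \<le> 1"
  show "\<exists>s. 0 \<le> s \<and> s \<le> 1 \<and> x = (1 - t) * s + t"
  \<comment> \<open>For \<open>t = 1\<close> the affine map is constant and \<open>x = 1\<close>, so
    any \<open>s\<close> serves; otherwise the map is inverted.\<close>
  proof (cases "t = 1")
    case True
    then show ?thesis using x by (intro exI[of _ 0]) auto
  next
    case False
    then show ?thesis
      using x t by (intro exI[of _ "(x - t) / (1 - t)"]) (auto simp: divide_le_eq_1)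
  qed
qed

lemma between_t: "(\<exists>u. 0 \<le> u \<and> u \<le> 1 \<and> z = t * u) \<longleftrightarrow> 0 \<le> z \<and> z \<le> t"
proof
  assume "0 \<le> z \<and> z \<le> t"
  \<comment> \<open>For \<open>t = 0\<close> also \<open>z = 0\<close>, and the convention
    \<open>0 / 0 = 0\<close> keeps the quotient a valid witness.\<close>
  then show "\<exists>u. 0 \<le> u \<and> u \<le> 1 \<and> z = t * u"
    using t by (intro exI[of _ "z / t"]) (auto simp: divide_le_eq_1)
qed (use t in \<open>auto simp: mult_left_le\<close>)

lemma between_minus_t: "(\<exists>v. - 1 \<le> v \<and> v \<le> 0 \<and> z = t * v) \<longleftrightarrow> - t \<le> z \<and> z \<le> 0"
proof -
  have "(\<exists>v. - 1 \<le> v \<and> v \<le> 0 \<and> z = t * v) \<longleftrightarrow> (\<exists>u. 0 \<le> u \<and> u \<le> 1 \<and> - z = t * u)"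
    (is "?L \<longleftrightarrow> ?R")
  proof
    assume ?L
    then obtain v where "- 1 \<le> v" "v \<le> 0" "z = t * v" by blast
    then show ?R by (intro exI[of _ "- v"]) auto
  next
    assume ?R
    then obtain u where "0 \<le> u" "u \<le> 1" "- z = t * u" by blast
    then show ?L by (intro exI[of _ "- u"]) auto
  qed
  then show ?thesis by (auto simp: between_t)
qed

lemma slice_S: "(x, y) \<in> slice t S_sq \<longleftrightarrow> 0 \<le> x \<and> x \<le> t \<and> 0 \<le> y \<and> y \<le> t"
proof -
  have "(x, y) \<in> slice t S_sq \<longleftrightarrow>
      (\<exists>u. 0 \<le> u \<and> u \<le> 1 \<and> x = t * u) \<and> (\<exists>v. 0 \<le> v \<and> v \<le> 1 \<and> y = t * v)"
    by (simp add: slice_flat S_sq_def) blast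
  then show ?thesis by (simp add: between_t)
qed

lemma slice_T: "(x, y) \<in> slice t T_sq \<longleftrightarrow> 0 \<le> x \<and> x \<le> t \<and> - t \<le> y \<and> y \<le> 0"
proof -
  have "(x, y) \<in> slice t T_sq \<longleftrightarrow>
      (\<exists>u. 0 \<le> u \<and> u \<le> 1 \<and> x = t * u) \<and> (\<exists>v. - 1 \<le> v \<and> v \<le> 0 \<and> y = t * v)"
    by (simp add: slice_flat T_sq_def) blast
  then show ?thesis by (simp add: between_t between_minus_t)
qed

lemma slice_G2: "(x, y) \<in> slice t G2 \<longleftrightarrow> x = t \<and> - t \<le> y \<and> y \<le> 0"
proof -
  have "(x, y) \<in> slice t G2 \<longleftrightarrow> x = t \<and> (\<exists>v. - 1 \<le> v \<and> v \<le> 0 \<and> y = t * v)"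
    by (simp add: slice_flat G2_def) blast
  then show ?thesis by (simp add: between_minus_t)
qed

lemma slice_G3: "(x, y) \<in> slice t G3 \<longleftrightarrow> y = - t \<and> 0 \<le> x \<and> x \<le> t"
proof -
  have "(x, y) \<in> slice t G3 \<longleftrightarrow> (\<exists>u. 0 \<le> u \<and> u \<le> 1 \<and> x = t * u) \<and> y = - t"
    by (simp add: slice_flat G3_def) blast
  then show ?thesis by (auto simp: between_t)
qed

text \<open>The swept edge is a parallelogram. In the coordinates \<open>x\<close> and
  \<open>x - y\<close> it becomes a rectangle: \<open>x\<close> depends on \<open>s\<close> alone,
  and \<open>x - y = t * (1 - v)\<close> on \<open>v\<close> alone.\<close>

lemma slice_E2: "(x, y) \<in> slice t E2 \<longleftrightarrow> t \<le> x \<and> x \<le> 1 \<and> y \<le> x \<and> x - y \<le> t"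
proof -
  have "(x, y) \<in> slice t E2 \<longleftrightarrow>
      (\<exists>s v. 0 \<le> s \<and> s \<le> 1 \<and> 0 \<le> v \<and> v \<le> 1 \<and> x = (1 - t) * s + t \<and> y = (1 - t) * s + t * v)"
    by (auto simp: slice_diag E2_def)
  also have "\<dots> \<longleftrightarrow> (\<exists>s w. 0 \<le> s \<and> s \<le> 1 \<and> 0 \<le> w \<and> w \<le> 1 \<and> x = (1 - t) * s + t \<and> x - y = t * w)"
    (is "?L \<longleftrightarrow> ?R")
  proof
    assume ?L
    then obtain s v where "0 \<le> s" "s \<le> 1" "0 \<le> v" "v \<le> 1" "x = (1 - t) * s + t" "y = (1 - t) * s + t * v"
      by blast
    then show ?R by (intro exI[of _ s] exI[of _ "1 - v"]) (auto simp: algebra_simps)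
  next
    assume ?R
    then obtain s v where "0 \<le> s" "s \<le> 1" "0 \<le> v" "v \<le> 1" "x = (1 - t) * s + t" "x - y = t * v"
      by blast
    then show ?L by (intro exI[of _ s] exI[of _ "1 - v"]) (auto simp: algebra_simps)
  qed
  also have "\<dots> \<longleftrightarrow> (\<exists>s. 0 \<le> s \<and> s \<le> 1 \<and> x = (1 - t) * s + t) \<and> (\<exists>w. 0 \<le> w \<and> w \<le> 1 \<and> x - y = t * w)"
    by blast
  finally show ?thesis by (simp add: between_one between_t)
qed

lemma slice_v2: "(x, y) \<in> slice t {v2} \<longleftrightarrow> t \<le> x \<and> x \<le> 1 \<and> x - y = t"
proof -
  have "(x, y) \<in> slice t {v2} \<longleftrightarrow> (\<exists>s. 0 \<le> s \<and> s \<le> 1 \<and> x = (1 - t) * s + t) \<and> x - y = t"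
    by (auto simp: slice_diag v2_def)
  then show ?thesis by (simp add: between_one)
qed

end

text \<open>Reflection in the diagonal fixes the segment \<open>I_set 1\<close> and exchanges
  \<open>E2\<close> with \<open>E3\<close> and \<open>v2\<close> with \<open>v3\<close>.\<close>

lemma slice_swap: "(x, y) \<in> slice t E3 \<longleftrightarrow> (y, x) \<in> slice t E2"
  "(x, y) \<in> slice t {v3} \<longleftrightarrow> (y, x) \<in> slice t {v2}"
  by (simp add: slice_diag E2_def E3_def v2_def v3_def, blast)+

lemmas slice_simps = slice_S slice_T slice_G2 slice_G3 slice_E2 slice_v2 slice_swap

section \<open>Faces sorted by the index of their vertex or \<open>G\<close> edge\<close>

definition tops :: "nat \<Rightarrow> 'n::{finite,linorder} \<Rightarrow> (real \<times> real) set set" where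
  "tops k i = (if pos i \<le> k then {{v2}, {v3}} else {G2, G3})"

definition others :: "nat \<Rightarrow> 'n::{finite,linorder} \<Rightarrow> (real \<times> real) set set" where
  "others k i = (if pos i \<le> k then {S_sq, E2, E3} else {T_sq})"

text \<open>Treats both kinds of faces uniformly: \<open>m\<close> carries the vertex or the
  \<open>G\<close> edge, and the level \<open>l\<close> is left out because \<open>n_E F\<close>
  determines it. As a full product of choices, the set can be counted factor by factor.\<close>

definition cells :: "nat \<Rightarrow> 'n::{finite,linorder} \<Rightarrow> ('n \<Rightarrow> (real \<times> real) set) set" where
  "cells k m = PiE UNIV (\<lambda>i. if i = m then tops k i else others k i)"

lemma mem_cells: "F \<in> cells k m \<longleftrightarrow> F m \<in> tops k m \<and> (\<forall>i. i \<noteq> m \<longrightarrow> F i \<in> others k i)"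
  by (auto simp: cells_def PiE_iff)

lemma tops_others_disjoint: "tops k i \<inter> others k i = {}"
  by (auto simp: tops_def others_def squares_neq)

text \<open>Since \<open>tops\<close> and \<open>others\<close> are disjoint, the index can be read
  off \<open>F\<close>. This makes the cardinalities of the \<open>cells k m\<close>
  additive.\<close>

lemma cells_index_unique: "F \<in> cells k m \<Longrightarrow> F \<in> cells k m' \<Longrightarrow> m = m'"
  using tops_others_disjoint by (fastforce simp: mem_cells)

text \<open>\<open>pos\<close> is the rank in the linear order: strictly increasing, hence
  injective, and an injection of \<open>d\<close> elements into \<open>{1..d}\<close> is
  onto.\<close>

lemma pos_range: "pos ` (UNIV :: 'n::{finite,linorder} set) = {1..CARD('n)}" and inj_pos: "inj (pos :: 'n \<Rightarrow> nat)"
proof -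
  have less: "pos i < pos j" if "i < j" for i j :: 'n
    unfolding pos_def using that by (intro psubset_card_mono) (auto simp: psubset_eq simp flip: atMost_def)
  then show inj: "inj (pos :: 'n \<Rightarrow> nat)"
    by (intro linorder_injI) (metis less_irrefl)
  have "1 \<le> pos i \<and> pos i \<le> CARD('n)" for i :: 'n
  proof -
    have "card {i} \<le> pos i" unfolding pos_def by (intro card_mono) auto
    then show ?thesis by (auto simp: pos_def intro: card_mono)
  qed
  then have "pos ` (UNIV :: 'n set) \<subseteq> {1..CARD('n)}" by auto
  then show "pos ` (UNIV :: 'n set) = {1..CARD('n)}"
    by (intro card_subset_eq) (auto simp: card_image inj)
qed

lemma card_pos_le:
  assumes "k \<le> CARD('n::{finite,linorder})"
  shows "card {i :: 'n. pos i \<le> k} = k"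
proof -
  have "pos ` {i :: 'n. pos i \<le> k} = {1..k}"
  proof -
    have "pos ` {i :: 'n. pos i \<le> k} = pos ` (UNIV :: 'n set) \<inter> {..k}" by auto
    also have "\<dots> = {1..k}" using assms by (auto simp: pos_range)
    finally show ?thesis .
  qed
  then show ?thesis
    by (metis card_image inj_pos inj_on_subset subset_UNIV card_atLeastAtMost diff_Suc_1)
qed

text \<open>The union over \<open>l\<close> removes the condition on the number of edges: with one
  of the \<open>k\<close> square factors \<open>S\<close> used by the vertex, at most
  \<open>k - 1\<close> edges remain possible, so the levels end exactly at
  \<open>k + 1\<close>.\<close>

lemma cells_B1:
  assumes k: "k \<le> CARD('n::{finite,linorder})"
  shows "(\<Union>l\<in>{2..k+1}. B1 k l) = (\<Union>m\<in>{m :: 'n. pos m \<le> k}. cells k m)"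
proof (intro equalityI subsetI)
  fix F :: "'n \<Rightarrow> (real \<times> real) set"
  assume "F \<in> (\<Union>l\<in>{2..k+1}. B1 k l)"
  then have F: "F i \<in> (if pos i \<le> k then {S_sq, E2, E3, {v2}, {v3}} else {T_sq})" "n_V F = 1" for i
    by (auto simp: B1_def)
  from F(2) obtain m where m: "{i. F i \<in> {{v2}, {v3}}} = {m}"
    unfolding n_V_def by (auto simp: card_1_singleton_iff)
  then have m1: "F m \<in> {{v2}, {v3}}" by blast
  from m have m2: "F i \<notin> {{v2}, {v3}}" if "i \<noteq> m" for i
    using that by blast
  have "pos m \<le> k"
    using m1 F(1)[of m] by (auto simp: squares_neq split: if_splits)
  moreover have "F i \<in> others k i" if "i \<noteq> m" for i
    using F(1)[of i] m2[OF that] by (auto simp: others_def split: if_splits)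
  ultimately show "F \<in> (\<Union>m\<in>{m. pos m \<le> k}. cells k m)"
    using m1 by (auto simp: mem_cells tops_def)
next
  fix F :: "'n \<Rightarrow> (real \<times> real) set"
  assume "F \<in> (\<Union>m\<in>{m. pos m \<le> k}. cells k m)"
  then obtain m where m: "pos m \<le> k" "F m \<in> {{v2}, {v3}}" "\<And>i. i \<noteq> m \<Longrightarrow> F i \<in> others k i"
    by (auto simp: mem_cells tops_def)
  have "F i \<notin> {{v2}, {v3}}" if "i \<noteq> m" for i
    using m(3)[OF that] by (auto simp: others_def squares_neq split: if_splits)
  then have "{i. F i \<in> {{v2}, {v3}}} = {m}"
    using m(2) by blast
  then have "n_V F = 1" by (simp add: n_V_def)
  have "{i. F i \<in> {E2, E3}} \<subseteq> {i. pos i \<le> k} - {m}"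
  proof
    fix i assume i: "i \<in> {i. F i \<in> {E2, E3}}"
    then have "i \<noteq> m" using m(2) by (auto simp: squares_neq)
    then show "i \<in> {i. pos i \<le> k} - {m}"
      using i m(3)[of i] by (auto simp: others_def squares_neq split: if_splits)
  qed
  then have "n_E F \<le> card ({i :: 'n. pos i \<le> k} - {m})"
    unfolding n_E_def by (intro card_mono) auto
  also have "\<dots> = k - 1" using m(1) by (simp add: card_pos_le[OF k])
  finally have "n_E F \<le> k - 1" .
  \<comment> \<open>The index \<open>m\<close> forces \<open>k > 0\<close>, so the truncated
    \<open>k - 1\<close> is a true difference.\<close>
  moreover have "card {i :: 'n. pos i \<le> k} \<noteq> 0" using m(1) by auto
  ultimately have "n_E F + 2 \<le> k + 1" by (simp add: card_pos_le[OF k])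
  moreover have "F i \<in> (if pos i \<le> k then {S_sq, E2, E3, {v2}, {v3}} else {T_sq})" for i
    using m(1,2) m(3)[of i] by (cases "i = m") (auto simp: others_def split: if_splits)
  ultimately show "F \<in> (\<Union>l\<in>{2..k+1}. B1 k l)"
    using \<open>n_V F = 1\<close> by (auto simp: B1_def intro!: bexI[of _ "n_E F + 2"])
qed

text \<open>As for the vertex faces, but the \<open>G\<close> edge sits at an index beyond
  \<open>k\<close>. All \<open>k\<close> square factors may then be edges, and the last level is
  again \<open>k + 1\<close>.\<close>

lemma cells_B2:
  assumes k: "k \<le> CARD('n::{finite,linorder})"
  shows "(\<Union>l\<in>{1..k+1}. B2 k l) = (\<Union>m\<in>{m :: 'n. k < pos m}. cells k m)"
proof (intro equalityI subsetI)
  fix F :: "'n \<Rightarrow> (real \<times> real) set"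
  assume "F \<in> (\<Union>l\<in>{1..k+1}. B2 k l)"
  then have F: "F i \<in> (if pos i \<le> k then {S_sq, E2, E3} else {T_sq, G2, G3})" "n_G F = 1" for i
    by (auto simp: B2_def)
  from F(2) obtain m where m: "{i. F i \<in> {G2, G3}} = {m}"
    unfolding n_G_def by (auto simp: card_1_singleton_iff)
  then have m1: "F m \<in> {G2, G3}" by blast
  from m have m2: "F i \<notin> {G2, G3}" if "i \<noteq> m" for i
    using that by blast
  have "k < pos m"
    using m1 F(1)[of m] by (auto simp: squares_neq split: if_splits)
  moreover have "F i \<in> others k i" if "i \<noteq> m" for i
    using F(1)[of i] m2[OF that] by (auto simp: others_def split: if_splits)
  ultimately show "F \<in> (\<Union>m\<in>{m. k < pos m}. cells k m)"
    using m1 by (auto simp: mem_cells tops_def)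
next
  fix F :: "'n \<Rightarrow> (real \<times> real) set"
  assume "F \<in> (\<Union>m\<in>{m. k < pos m}. cells k m)"
  then obtain m where m: "k < pos m" "F m \<in> {G2, G3}" "\<And>i. i \<noteq> m \<Longrightarrow> F i \<in> others k i"
    by (auto simp: mem_cells tops_def)
  have "F i \<notin> {G2, G3}" if "i \<noteq> m" for i
    using m(3)[OF that] by (auto simp: others_def squares_neq split: if_splits)
  then have "{i. F i \<in> {G2, G3}} = {m}"
    using m(2) by blast
  then have "n_G F = 1" by (simp add: n_G_def)
  have "{i. F i \<in> {E2, E3}} \<subseteq> {i. pos i \<le> k}"
  proof
    fix i assume i: "i \<in> {i. F i \<in> {E2, E3}}"
    then have "i \<noteq> m" using m(2) by (auto simp: squares_neq)
    then show "i \<in> {i. pos i \<le> k}"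
      using i m(3)[of i] by (auto simp: others_def squares_neq split: if_splits)
  qed
  then have "n_E F \<le> card {i :: 'n. pos i \<le> k}"
    unfolding n_E_def by (intro card_mono) auto
  then have "n_E F + 1 \<le> k + 1" by (simp add: card_pos_le[OF k])
  moreover have "F i \<in> (if pos i \<le> k then {S_sq, E2, E3} else {T_sq, G2, G3})" for i
    using m(1,2) m(3)[of i] by (cases "i = m") (auto simp: others_def split: if_splits)
  ultimately show "F \<in> (\<Union>l\<in>{1..k+1}. B2 k l)"
    using \<open>n_G F = 1\<close> by (auto simp: B2_def intro!: bexI[of _ "n_E F + 1"])
qed

text \<open>A term is a face with a level and a side of the disjoint sum. Both are determined by the
  face: the level by \<open>n_E\<close>, the side by the presence of a vertex. Counting and
  comparing terms thus reduces to faces.\<close>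

lemma bij_betw_union_terms:
  assumes k: "k \<le> CARD('n::{finite,linorder})"
  shows "bij_betw (case_sum snd snd) (union_terms k :: ('n index + 'n index) set) (\<Union>m. cells k m)"
proof -
  let ?f = "case_sum snd snd :: 'n index + 'n index \<Rightarrow> _"
  have "?f ` union_terms k = (\<Union>l\<in>{2..k+1}. B1 k l) \<union> (\<Union>l\<in>{1..k+1}. B2 k l)"
    by (force simp: union_terms_def Plus_def image_Un image_image image_iff)
  also have "\<dots> = (\<Union>m. cells k m)"
    unfolding cells_B1[OF k] cells_B2[OF k] by (auto simp: not_le[symmetric])
  finally have img: "?f ` union_terms k = (\<Union>m. cells k m)" .
  have sep: "F \<notin> B2 k l'" if "F \<in> B1 k l" for F :: "'n \<Rightarrow> (real \<times> real) set" and l l'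
  proof
    assume B2: "F \<in> B2 k l'"
    from that have "{i. F i \<in> {{v2}, {v3}}} \<noteq> {}"
      unfolding B1_def n_V_def by force
    then obtain i where "F i \<in> {{v2}, {v3}}" by blast
    with B2 show False
      by (auto simp: B2_def squares_neq split: if_splits dest!: spec[of _ i])
  qed
  have "inj_on ?f (union_terms k)"
    unfolding union_terms_def
    by (intro inj_onI) (auto simp: Plus_def B1_def[of _ l for l] B2_def[of _ l for l] dest: sep)
  with img show ?thesis by (simp add: bij_betw_def)
qed

section \<open>The number of terms\<close>

lemma card_cells:
  assumes k: "k \<le> CARD('n::{finite,linorder})"
  shows "card (cells k (m :: 'n)) = (if pos m \<le> k then 2 * 3 ^ (k - 1) else 2 * 3 ^ k)"
proof -
  have tops: "card (tops k m) = 2"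
    by (simp add: tops_def squares_neq)
  have others: "card (others k i) = (if pos i \<le> k then 3 else 1)" for i :: 'n
    by (simp add: others_def squares_neq)
  have "card (cells k m) = (\<Prod>i\<in>UNIV. card (if i = m then tops k i else others k i))"
    by (simp add: cells_def card_PiE)
  also have "\<dots> = card (tops k m) * (\<Prod>i\<in>UNIV - {m}. card (others k i))"
    by (subst prod.remove[of _ m]) auto
  \<comment> \<open>An index beyond \<open>k\<close> offers the single choice \<open>T_sq\<close>
    and contributes the factor 1.\<close>
  also have "(\<Prod>i\<in>UNIV - {m}. card (others k i)) = (\<Prod>i\<in>{i. pos i \<le> k} - {m}. 3)"
    by (intro prod.mono_neutral_cong_right) (auto simp: others)
  also have "\<dots> = 3 ^ card ({i. pos i \<le> k} - {m})" by simp
  finally show ?thesis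
    using card_pos_le[OF k] tops by (auto simp: card_Diff_singleton_if)
qed

text \<open>Of the indices \<open>m\<close>, \<open>k\<close> contribute
  \<open>2 * 3 ^ (k - 1)\<close> faces each and \<open>d - k\<close> contribute three times as many,
  and \<open>2 * (k + 3 * (d - k)) = 6 * d - 4 * k\<close>.\<close>

lemma card_union_terms:
  assumes k: "k \<le> CARD('n::{finite,linorder})"
  shows "real (card (union_terms k :: ('n index + 'n index) set)) =
    (6 * real CARD('n) - 4 * real k) * 3 powi (int k - 1)"
proof -
  let ?K = "{m :: 'n. pos m \<le> k}"
  have fin: "finite (cells k m)" for m :: 'n
    by (auto simp: cells_def tops_def others_def intro!: finite_PiE)
  have "card (union_terms k :: ('n index + 'n index) set) = card (\<Union>m :: 'n. cells k m)"
    by (rule bij_betw_same_card[OF bij_betw_union_terms[OF k]])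
  also have "\<dots> = (\<Sum>m :: 'n\<in>UNIV. card (cells k m))"
    using cells_index_unique by (intro card_UN_disjoint) (auto simp: fin)
  also have "\<dots> = (\<Sum>m\<in>?K. 2 * 3 ^ (k - 1)) + (\<Sum>m\<in>- ?K. 2 * 3 ^ k)"
    by (simp add: card_cells[OF k] sum.If_cases)
  also have "\<dots> = k * (2 * 3 ^ (k - 1)) + (CARD('n) - k) * (2 * 3 ^ k)"
    by (simp add: card_pos_le[OF k] card_Diff_subset Compl_eq_Diff_UNIV)
  finally have "real (card (union_terms k :: ('n index + 'n index) set)) =
      real k * (2 * 3 ^ (k - 1)) + (real CARD('n) - real k) * (2 * 3 ^ k)"
    using k by simp
  \<comment> \<open>For \<open>k = 0\<close> the natural exponent \<open>k - 1\<close> is 0 but the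
    integer power is \<open>1 / 3\<close>. The summand with the truncated exponent has the factor
    \<open>k\<close>, so both sides equal \<open>2 * d\<close>.\<close>
  then show ?thesis
    by (cases k) (simp_all add: algebra_simps power_int_minus)
qed

section \<open>The parameter of a point, and the covering\<close>

definition height :: "nat \<Rightarrow> (real \<times> real) ^ 'n::{finite,linorder} \<Rightarrow> 'n \<Rightarrow> real" where
  "height k p i = (if pos i \<le> k then \<bar>fst (p $ i) - snd (p $ i)\<bar> else max (fst (p $ i)) (- snd (p $ i)))"

text \<open>The gradient of the linear function that computes \<open>t\<close> on the slice of a top
  factor: \<open>x - y\<close>, \<open>y - x\<close>, \<open>x\<close> or \<open>- y\<close>. The
  last branch is meant for \<open>G3\<close>.\<close>

definition dir :: "(real \<times> real) set \<Rightarrow> real \<times> real" where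
  "dir X = (if X = {v2} then (1, -1) else if X = {v3} then (-1, 1) else if X = G2 then (1, 0) else (0, -1))"

lemma slice_height:
  assumes t: "0 \<le> t" "t \<le> 1"
  shows slice_tops: "p $ i \<in> slice t X \<Longrightarrow> X \<in> tops k i \<Longrightarrow> height k p i = t \<and> dir X \<bullet> p $ i = t"
    and slice_others: "p $ i \<in> slice t X \<Longrightarrow> X \<in> others k i \<Longrightarrow> height k p i \<le> t"
proof -
  obtain x y where p: "p $ i = (x, y)" by fastforce
  assume X: "p $ i \<in> slice t X" "X \<in> tops k i"
  show "height k p i = t \<and> dir X \<bullet> p $ i = t"
  proof (cases "pos i \<le> k")
    case True
    with X(2) consider "X = {v2}" | "X = {v3}" by (auto simp: tops_def)
    then show ?thesis
      using X(1) True t by cases (auto simp: p height_def dir_def squares_neq slice_simps)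
  next
    case False
    with X(2) consider "X = G2" | "X = G3" by (auto simp: tops_def)
    then show ?thesis
      using X(1) False t by cases (auto simp: p height_def dir_def squares_neq slice_simps)
  qed
next
  obtain x y where p: "p $ i = (x, y)" by fastforce
  assume X: "p $ i \<in> slice t X" "X \<in> others k i"
  show "height k p i \<le> t"
  proof (cases "pos i \<le> k")
    case True
    with X(2) consider "X = S_sq" | "X = E2" | "X = E3" by (auto simp: others_def)
    then show ?thesis
      using X(1) True t by cases (auto simp: p height_def slice_simps)
  next
    case False
    with X have "(x, y) \<in> slice t T_sq" by (simp add: others_def p)
    with False t show ?thesis by (simp add: p height_def slice_simps)
  qed
qed

text \<open>The height equals \<open>t\<close> at \<open>m\<close> and is at most \<open>t\<close>
  elsewhere, so \<open>t\<close> is determined by \<open>p\<close> alone. Two pieces through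
  \<open>p\<close> therefore use the same parameter.\<close>

lemma mem_cell_piece:
  assumes F: "F \<in> cells k m" and p: "p \<in> conv (A_face F) (face F)"
  obtains t where "0 \<le> t" "t \<le> 1" "\<And>i. p $ i \<in> slice t (F i)"
    "t = Max (range (height k p))" "dir (F m) \<bullet> p $ m = t"
proof -
  from p obtain t where t: "0 \<le> t" "t \<le> 1" and s: "\<And>i. p $ i \<in> slice t (F i)"
    by (auto simp: mem_conv_A_face)
  have m: "height k p m = t" "dir (F m) \<bullet> p $ m = t"
    using slice_tops[OF t s, of m k] F by (auto simp: mem_cells)
  have "height k p i \<le> t" for i
    using slice_others[OF t s, of i k] F m(1) by (cases "i = m") (auto simp: mem_cells)
  then have "t = Max (range (height k p))"
    using m(1) by (intro Max_eqI[symmetric]) auto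
  with that t s m(2) show thesis by blast
qed

text \<open>Each slice stays in its square. Conversely, once \<open>t\<close> is the maximal height
  and \<open>m\<close> an index attaining it, the factors of a suitable face can be chosen
  independently.\<close>

lemma cells_cover:
  fixes k :: nat
  defines "P \<equiv> {p :: (real \<times> real) ^ 'n::{finite,linorder}. \<forall>i. p $ i \<in> (if pos i \<le> k then S_sq else T_sq)}"
  shows "(\<Union>m. \<Union>F\<in>cells k m. conv (A_face F) (face F)) = P"
proof (intro equalityI subsetI)
  fix p :: "(real \<times> real) ^ 'n::{finite,linorder}"
  assume "p \<in> (\<Union>m. \<Union>F\<in>cells k m. conv (A_face F) (face F))"
  then obtain m F where F: "F \<in> cells k m" "p \<in> conv (A_face F) (face F)" by blast
  obtain t where t: "0 \<le> t" "t \<le> 1" and s: "\<And>i. p $ i \<in> slice t (F i)"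
    using mem_cell_piece[OF F] by metis
  have "p $ i \<in> (if pos i \<le> k then S_sq else T_sq)" for i
  proof -
    obtain x y where xy: "p $ i = (x, y)" by fastforce
    have "F i \<in> tops k i \<union> others k i" using F(1) by (cases "i = m") (auto simp: mem_cells)
    then show ?thesis
      using s[of i] t by (auto simp: xy tops_def others_def slice_simps mem_S_sq mem_T_sq split: if_splits)
  qed
  then show "p \<in> P" by (simp add: P_def)
next
  fix p :: "(real \<times> real) ^ 'n::{finite,linorder}"
  assume p: "p \<in> P"
  define t where "t = Max (range (height k p))"
  have "t \<in> range (height k p)" unfolding t_def by (intro Max_in) auto
  then obtain m where m: "height k p m = t" by auto
  have le: "height k p i \<le> t" for i by (simp add: t_def)
  have "0 \<le> height k p i \<and> height k p i \<le> 1" for i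
    using p by (auto simp: P_def height_def S_sq_def T_sq_def mem_Times_iff abs_le_iff split: if_splits dest!: spec[of _ i])
  then have t: "0 \<le> t" "t \<le> 1" using m by metis+
  \<comment> \<open>The linear function attaining the height at \<open>m\<close> selects the factor;
    on \<open>S_sq\<close> the larger coordinate is at least \<open>t\<close> because the smaller
    one is nonnegative.\<close>
  have top: "\<exists>X\<in>tops k m. p $ m \<in> slice t X"
  proof -
    obtain x y where xy: "p $ m = (x, y)" by fastforce
    have "(x, y) \<in> (if pos m \<le> k then S_sq else T_sq)" using p xy by (metis (mono_tags, lifting) P_def mem_Collect_eq)
    then show ?thesis
      using m t by (auto simp: xy tops_def height_def slice_simps mem_S_sq mem_T_sq abs_if max_def split: if_splits)
  qed
  \<comment> \<open>On an \<open>S\<close> factor, \<open>S_sq\<close> serves if both coordinates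
    are at most \<open>t\<close>; otherwise the larger coordinate exceeds \<open>t\<close> and
    selects \<open>E2\<close> or \<open>E3\<close>.\<close>
  have other: "\<exists>X\<in>others k i. p $ i \<in> slice t X" for i
  proof -
    obtain x y where xy: "p $ i = (x, y)" by fastforce
    have "(x, y) \<in> (if pos i \<le> k then S_sq else T_sq)" using p xy by (metis (mono_tags, lifting) P_def mem_Collect_eq)
    then show ?thesis
      using le[of i] t by (auto simp: xy others_def height_def slice_simps mem_S_sq mem_T_sq abs_if max_def split: if_splits)
  qed
  obtain X where X: "X \<in> tops k m" "p $ m \<in> slice t X" using top by blast
  obtain Y where Y: "\<And>i. Y i \<in> others k i" "\<And>i. p $ i \<in> slice t (Y i)" using other by metis
  have "Y(m := X) \<in> cells k m" using X Y by (simp add: mem_cells)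
  moreover have "p \<in> conv (A_face (Y(m := X))) (face (Y(m := X)))"
    unfolding mem_conv_A_face using X Y t by (intro bexI[of _ t]) auto
  ultimately show "p \<in> (\<Union>m. \<Union>F\<in>cells k m. conv (A_face F) (face F))" by blast
qed

section \<open>Disjointness of the interiors\<close>

lemma interior_disjoint_hyperplane:
  fixes a :: "'a::euclidean_space"
  assumes "a \<noteq> 0" "A \<inter> B \<subseteq> {x. a \<bullet> x = 0}"
  shows "interior A \<inter> interior B = {}"
proof -
  have "interior (A \<inter> B) \<subseteq> interior {x. a \<bullet> x = 0}"
    by (rule interior_mono[OF assms(2)])
  then show ?thesis by (simp only: interior_Int interior_hyperplane[OF assms(1)] subset_empty)
qed

text \<open>\<open>axis i u\<close> represents the functional taking \<open>p\<close> to
  \<open>u \<bullet> p $ i\<close>; differences of two such vectors are the normals of the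
  separating hyperplanes.\<close>

lemma axis_diff_nonzero:
  assumes "u \<noteq> 0" "(i, u) \<noteq> (j, v)"
  shows "axis i u - axis j v \<noteq> (0 :: 'a::real_vector ^ 'n::finite)"
proof
  assume "axis i u - axis j v = 0"
  then have "axis i u $ i = axis j v $ i" by simp
  then show False using assms by (auto simp: axis_def split: if_splits)
qed

text \<open>Two of these slices meet only on a line: \<open>x = t\<close>, \<open>y = t\<close> or
  \<open>x = y\<close>. The coefficients \<open>w\<close> and \<open>r\<close> do not depend on
  \<open>t\<close>, so the equation is linear in the point and \<open>t\<close> jointly.\<close>

lemma others_overlap:
  assumes "X \<in> {S_sq, E2, E3}" "Y \<in> {S_sq, E2, E3}" "X \<noteq> Y"
  shows "\<exists>w r. w \<noteq> 0 \<and> (\<forall>t q. 0 \<le> t \<longrightarrow> t \<le> 1 \<longrightarrow> q \<in> slice t X \<longrightarrow> q \<in> slice t Y \<longrightarrow> w \<bullet> q = r * t)"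
    (is "?P X Y")
proof -
  have "?P S_sq E2"
    by (intro exI[of _ "(1, 0)"] exI[of _ 1]) (auto simp: slice_simps zero_prod_def)
  moreover have "?P S_sq E3"
    by (intro exI[of _ "(0, 1)"] exI[of _ 1]) (auto simp: slice_simps zero_prod_def)
  moreover have "?P E2 E3"
    by (intro exI[of _ "(1, - 1)"] exI[of _ 0]) (auto simp: slice_simps zero_prod_def)
  moreover have "?P Y X" if "?P X Y" for X Y
    using that by blast
  ultimately show ?thesis
    using assms unfolding insert_iff empty_iff by metis
qed

lemma pieces_interior_disjoint:
  fixes F F' :: "'n::{finite,linorder} \<Rightarrow> (real \<times> real) set"
  assumes F: "F \<in> cells k m" and F': "F' \<in> cells k m'" and "F \<noteq> F'"
  shows "interior (conv (A_face F) (face F)) \<inter> interior (conv (A_face F') (face F')) = {}"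
proof -
  let ?C = "conv (A_face F) (face F) \<inter> conv (A_face F') (face F')"
  have common: "\<exists>t. 0 \<le> t \<and> t \<le> 1 \<and> (\<forall>i. p $ i \<in> slice t (F i) \<and> p $ i \<in> slice t (F' i)) \<and>
      dir (F m) \<bullet> p $ m = t \<and> dir (F' m') \<bullet> p $ m' = t" if "p \<in> ?C" for p
  proof -
    from that have p: "p \<in> conv (A_face F) (face F)" "p \<in> conv (A_face F') (face F')" by blast+
    obtain t where t: "0 \<le> t" "t \<le> 1" "\<And>i. p $ i \<in> slice t (F i)" "t = Max (range (height k p))"
        "dir (F m) \<bullet> p $ m = t"
      using mem_cell_piece[OF F p(1)] by blast
    obtain t' where t': "\<And>i. p $ i \<in> slice t' (F' i)" "t' = Max (range (height k p))"
        "dir (F' m') \<bullet> p $ m' = t'"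
      using mem_cell_piece[OF F' p(2)] by blast
    from t(4) t'(2) have "t' = t" by simp
    with t t' show ?thesis by blast
  qed
  have "\<exists>a. a \<noteq> 0 \<and> ?C \<subseteq> {p. a \<bullet> p = 0}"
  proof (cases "(m, F m) = (m', F' m')")
    \<comment> \<open>On \<open>?C\<close> both functionals return the common parameter, so their
      difference vanishes there.\<close>
    case False
    have "F m \<in> tops k m" "F' m' \<in> tops k m'" using F F' by (auto simp: mem_cells)
    with False have "dir (F m) \<noteq> 0" "(m, dir (F m)) \<noteq> (m', dir (F' m'))"
      by (auto simp: tops_def dir_def squares_neq zero_prod_def split: if_splits)
    then have "axis m (dir (F m)) - axis m' (dir (F' m')) \<noteq> 0" by (rule axis_diff_nonzero)
    moreover have "(axis m (dir (F m)) - axis m' (dir (F' m'))) \<bullet> p = 0" if "p \<in> ?C" for p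
      using common[OF that] by (auto simp: inner_diff_left inner_axis')
    ultimately show ?thesis by blast
  next
    case True
    obtain i where i: "F i \<noteq> F' i" using \<open>F \<noteq> F'\<close> by (auto simp: fun_eq_iff)
    with True have im: "i \<noteq> m" by auto
    then have "F i \<in> others k i" "F' i \<in> others k i" using F F' True by (auto simp: mem_cells)
    \<comment> \<open>Beyond \<open>k\<close> there is only one choice, so differing factors must
      belong to a square \<open>S\<close>.\<close>
    then have "F i \<in> {S_sq, E2, E3}" "F' i \<in> {S_sq, E2, E3}"
      using i by (auto simp: others_def split: if_splits)
    then obtain w r where w: "w \<noteq> 0"
        "\<And>t q. 0 \<le> t \<Longrightarrow> t \<le> 1 \<Longrightarrow> q \<in> slice t (F i) \<Longrightarrow> q \<in> slice t (F' i) \<Longrightarrow> w \<bullet> q = r * t"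
      using others_overlap i by metis
    \<comment> \<open>Replacing \<open>t\<close> by \<open>dir (F m) \<bullet> p $ m\<close> makes
      the overlap equation homogeneous in \<open>p\<close>. As \<open>i \<noteq> m\<close>, the
      normal is nonzero even when \<open>r = 0\<close>.\<close>
    have "axis i w - axis m (r *\<^sub>R dir (F m)) \<noteq> 0"
      using im w(1) by (intro axis_diff_nonzero) auto
    moreover have "(axis i w - axis m (r *\<^sub>R dir (F m))) \<bullet> p = 0" if "p \<in> ?C" for p
      using common[OF that] w(2)[of _ "p $ i"] by (auto simp: inner_diff_left inner_axis')
    ultimately show ?thesis by blast
  qed
  then show ?thesis using interior_disjoint_hyperplane by metis
qed

section \<open>The reordered product and the decomposition\<close>

lemma reorder_product:
  "reorder ` ((C_x :: (real ^ 'n::{finite,linorder}) set) \<times> C_y k) =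
    {p. \<forall>i. p $ i \<in> (if pos i \<le> k then S_sq else T_sq)}" (is "_ = ?P")
proof (intro equalityI subsetI)
  fix p :: "(real \<times> real) ^ 'n::{finite,linorder}"
  assume "p \<in> ?P"
  then have "(\<chi> i. fst (p $ i)) \<in> C_x" "(\<chi> i. snd (p $ i)) \<in> C_y k"
    by (auto simp: C_x_def C_y_def S_sq_def T_sq_def mem_Times_iff split: if_splits)
  moreover have "p = reorder ((\<chi> i. fst (p $ i)), (\<chi> i. snd (p $ i)))"
    by (simp add: reorder_def vec_eq_iff)
  ultimately show "p \<in> reorder ` (C_x \<times> C_y k)" by blast
qed (auto simp: reorder_def C_x_def C_y_def S_sq_def T_sq_def split: if_splits)

theorem theorem6p2:
  fixes k :: nat
  assumes "k \<le> CARD('n::{finite,linorder})"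
  shows
    "reorder ` ((C_x :: (real ^ 'n::{finite,linorder}) set) \<times> C_y k) =
       (\<Union>l\<in>{2..k+1}. \<Union>F\<in>B1 k l. conv (A_face F) (face F)) \<union>
       (\<Union>l\<in>{1..k+1}. \<Union>F\<in>B2 k l. conv (A_face F) (face F))
     \<and> disjoint_family_on (\<lambda>t. interior (piece t)) (union_terms k :: ('n::{finite,linorder} index + 'n::{finite,linorder} index) set)
     \<and> real (card (union_terms k :: ('n::{finite,linorder} index + 'n::{finite,linorder} index) set)) =
         (6 * real CARD('n::{finite,linorder}) - 4 * real k) * 3 powi (int k - 1)"
proof (intro conjI)
  let ?g = "\<lambda>F :: 'n \<Rightarrow> (real \<times> real) set. conv (A_face F) (face F)"
  have "(\<Union>l\<in>{2..k+1}. \<Union>F\<in>B1 k l. ?g F) \<union> (\<Union>l\<in>{1..k+1}. \<Union>F\<in>B2 k l. ?g F) =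
      (\<Union>F\<in>(\<Union>l\<in>{2..k+1}. B1 k l) \<union> (\<Union>l\<in>{1..k+1}. B2 k l). ?g F)"
    by blast
  also have "(\<Union>l\<in>{2..k+1}. B1 k l) \<union> (\<Union>l\<in>{1..k+1}. B2 k l) = (\<Union>m :: 'n. cells k m)"
    unfolding cells_B1[OF assms] cells_B2[OF assms] by (auto simp: not_le[symmetric])
  finally show "reorder ` (C_x \<times> C_y k) =
      (\<Union>l\<in>{2..k+1}. \<Union>F\<in>B1 k l. ?g F) \<union> (\<Union>l\<in>{1..k+1}. \<Union>F\<in>B2 k l. ?g F)"
    by (simp only: reorder_product UN_UN_flatten flip: cells_cover)
  \<comment> \<open>Injectivity turns distinct terms into distinct faces, as the hyperplane argument
    requires.\<close>
  have bij: "bij_betw (case_sum snd snd) (union_terms k :: ('n index + 'n index) set) (\<Union>m. cells k m)"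
    by (rule bij_betw_union_terms[OF assms])
  show "disjoint_family_on (\<lambda>t. interior (piece t)) (union_terms k :: ('n index + 'n index) set)"
    unfolding disjoint_family_on_def
  proof (intro ballI impI)
    fix s t :: "'n index + 'n index"
    assume s: "s \<in> union_terms k" and t: "t \<in> union_terms k" and "s \<noteq> t"
    then have "case_sum snd snd s \<noteq> case_sum snd snd t"
      using bij by (metis bij_betw_inv_into_left)
    moreover obtain m m' where "case_sum snd snd s \<in> cells k m" "case_sum snd snd t \<in> cells k m'"
      using bij_betw_apply[OF bij s] bij_betw_apply[OF bij t] by blast
    ultimately show "interior (piece s) \<inter> interior (piece t) = {}"
      unfolding piece_def Let_def by (intro pieces_interior_disjoint)
  qed
  show "real (card (union_terms k :: ('n index + 'n index) set)) =
      (6 * real CARD('n) - 4 * real k) * 3 powi (int k - 1)"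
    by (rule card_union_terms[OF assms])
qed

end
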